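(* The following data define a lax symmetric monoidal functor $\mathsf{NDD}\colon(\mathbf{FinSet},+)\to(\mathbf{Set},\times)$. (i) On objects, $\mathsf{NDD}$ takes a finite set $N$ to the set of functions $\upsilon\colon\mathbb{R}^N\to P\mathbb{R}^N$. (ii) For a function $\phi\colon N\to M$, the map $\mathsf{NDD}(\phi)\colon\mathsf{NDD}(N)\to\mathsf{NDD}(M)$ is $\upsilon\mapsto P\phi_*\circ\upsilon\circ\phi^*$. (iii) For finite sets $N,M$, the product comparison $\varphi_{N,M}\colon\mathsf{NDD}(N)\times\mathsf{NDD}(M)\to\mathsf{NDD}(N+M)$ is $$(\upsilon,\rho)\mapsto \bigl(P\iota_{N*}\circ\upsilon\circ\iota_N^*\bigr)\boxplus\bigl(P\iota_{M*}\circ\rho\circ\iota_M^*\bigr).$$ (iv) The unit comparison $\varphi_0\colon\{*\}\to\mathsf{NDD}(\emptyset)$ picks the function $\mathbb{R}^0\to P\mathbb{R}^0$, $0\mapsto\{0\}$.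
   Context: $(\mathbf{FinSet},+)$ is finite sets with disjoint union as monoidal product; $(\mathbf{Set},\times)$ is sets with Cartesian product. $P\colon\mathbf{Set}\to\mathbf{Set}$ is the covariant powerset functor: $P(X)$ is the set of all subsets of $X$, and $P(f)(A)$ is the image of $A$ under $f$. For a finite set $N$, $\mathbb{R}^N$ is the vector space of functions $N\to\mathbb{R}$, and $P\mathbb{R}^N$ is the powerset of its underlying set. For $\phi\colon N\to M$, $\phi^*\colon\mathbb{R}^M\to\mathbb{R}^N$ is $\phi^*(y)_i=y_{\phi(i)}$ and $\phi_*\colon\mathbb{R}^N\to\mathbb{R}^M$ is $\phi_*(x)_j=\sum_{i\in\phi^{-1}(j)}x_i$. $\iota_N,\iota_M$ are the inclusions of $N,M$ into $N+M$. $A\boxplus B=\{a+b\mid a\in A,b\in B\}$ is the Minkowski sum, applied pointwise to set-valued functions. *)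

theory Defs
  imports Complex_Main "HOL-Library.FuncSet"
begin

section \<open>Symmetric monoidal categories and lax symmetric monoidal functors\<close>

text \<open>Composition is in function order: \<open>g \<cdot> f\<close> is "first \<open>f\<close>, then \<open>g\<close>".
  Operations are only meaningful on the objects and the composable arrows of the category.\<close>

record ('o, 'a) cat =
  Obj  :: "'o set"
  Arr  :: "'a set"
  Dom  :: "'a \<Rightarrow> 'o"
  Cod  :: "'a \<Rightarrow> 'o"
  Idn  :: "'o \<Rightarrow> 'a" ("\<one>\<index>")
  Comp :: "'a \<Rightarrow> 'a \<Rightarrow> 'a" (infixr "\<cdot>\<index>" 65)

record ('o, 'a) moncat = "('o, 'a) cat" +
  Tens  :: "'o \<Rightarrow> 'o \<Rightarrow> 'o" (infixl "\<otimes>\<index>" 75)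
  TensA :: "'a \<Rightarrow> 'a \<Rightarrow> 'a" (infixl "\<odot>\<index>" 75)
  Unit  :: "'o"
  Assoc :: "'o \<Rightarrow> 'o \<Rightarrow> 'o \<Rightarrow> 'a"
  LUnit :: "'o \<Rightarrow> 'a"
  RUnit :: "'o \<Rightarrow> 'a"
  Braid :: "'o \<Rightarrow> 'o \<Rightarrow> 'a"

definition Hom :: "('o, 'a, 'm) cat_scheme \<Rightarrow> 'o \<Rightarrow> 'o \<Rightarrow> 'a set" ("Hom\<index>") where
  "Hom\<^bsub>C\<^esub> A B = {f \<in> Arr C. Dom C f = A \<and> Cod C f = B}"

definition Iso :: "('o, 'a, 'm) cat_scheme \<Rightarrow> 'o \<Rightarrow> 'o \<Rightarrow> 'a set" ("Iso\<index>") where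
  "Iso\<^bsub>C\<^esub> A B = {f \<in> Hom\<^bsub>C\<^esub> A B. \<exists>g \<in> Hom\<^bsub>C\<^esub> B A. g \<cdot>\<^bsub>C\<^esub> f = \<one>\<^bsub>C\<^esub> A \<and> f \<cdot>\<^bsub>C\<^esub> g = \<one>\<^bsub>C\<^esub> B}"

locale category =
  fixes C :: "('o, 'a, 'm) cat_scheme" (structure)
  assumes Dom_Obj: "f \<in> Arr C \<Longrightarrow> Dom C f \<in> Obj C"
    and Cod_Obj: "f \<in> Arr C \<Longrightarrow> Cod C f \<in> Obj C"
    and Idn_Hom: "A \<in> Obj C \<Longrightarrow> \<one> A \<in> Hom A A"
    and Comp_Hom: "\<lbrakk>f \<in> Hom A B; g \<in> Hom B D\<rbrakk> \<Longrightarrow> g \<cdot> f \<in> Hom A D"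
    and Comp_Idn_left: "f \<in> Hom A B \<Longrightarrow> \<one> B \<cdot> f = f"
    and Comp_Idn_right: "f \<in> Hom A B \<Longrightarrow> f \<cdot> \<one> A = f"
    and Comp_assoc: "\<lbrakk>f \<in> Hom A B; g \<in> Hom B D; h \<in> Hom D E\<rbrakk> \<Longrightarrow> (h \<cdot> g) \<cdot> f = h \<cdot> (g \<cdot> f)"

locale symmetric_monoidal_category = category C
  for C :: "('o, 'a, 'm) moncat_scheme" (structure) +
  assumes Unit_Obj: "Unit C \<in> Obj C"
    and Tens_Obj: "\<lbrakk>A \<in> Obj C; B \<in> Obj C\<rbrakk> \<Longrightarrow> A \<otimes> B \<in> Obj C"
    and TensA_Hom: "\<lbrakk>f \<in> Hom A A'; g \<in> Hom B B'\<rbrakk> \<Longrightarrow> f \<odot> g \<in> Hom (A \<otimes> B) (A' \<otimes> B')"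
    and TensA_Idn: "\<lbrakk>A \<in> Obj C; B \<in> Obj C\<rbrakk> \<Longrightarrow> \<one> A \<odot> \<one> B = \<one> (A \<otimes> B)"
    and TensA_Comp: "\<lbrakk>f \<in> Hom A A'; f' \<in> Hom A' A''; g \<in> Hom B B'; g' \<in> Hom B' B''\<rbrakk>
      \<Longrightarrow> (f' \<cdot> f) \<odot> (g' \<cdot> g) = (f' \<odot> g') \<cdot> (f \<odot> g)"
    and Assoc_Iso: "\<lbrakk>A \<in> Obj C; B \<in> Obj C; D \<in> Obj C\<rbrakk>
      \<Longrightarrow> Assoc C A B D \<in> Iso ((A \<otimes> B) \<otimes> D) (A \<otimes> (B \<otimes> D))"
    and Assoc_nat: "\<lbrakk>f \<in> Hom A A'; g \<in> Hom B B'; h \<in> Hom D D'\<rbrakk>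
      \<Longrightarrow> Assoc C A' B' D' \<cdot> ((f \<odot> g) \<odot> h) = (f \<odot> (g \<odot> h)) \<cdot> Assoc C A B D"
    and LUnit_Iso: "A \<in> Obj C \<Longrightarrow> LUnit C A \<in> Iso (Unit C \<otimes> A) A"
    and LUnit_nat: "f \<in> Hom A A' \<Longrightarrow> LUnit C A' \<cdot> (\<one> (Unit C) \<odot> f) = f \<cdot> LUnit C A"
    and RUnit_Iso: "A \<in> Obj C \<Longrightarrow> RUnit C A \<in> Iso (A \<otimes> Unit C) A"
    and RUnit_nat: "f \<in> Hom A A' \<Longrightarrow> RUnit C A' \<cdot> (f \<odot> \<one> (Unit C)) = f \<cdot> RUnit C A"
    and pentagon: "\<lbrakk>A \<in> Obj C; B \<in> Obj C; D \<in> Obj C; E \<in> Obj C\<rbrakk>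
      \<Longrightarrow> Assoc C A B (D \<otimes> E) \<cdot> Assoc C (A \<otimes> B) D E
        = (\<one> A \<odot> Assoc C B D E) \<cdot> Assoc C A (B \<otimes> D) E \<cdot> (Assoc C A B D \<odot> \<one> E)"
    and triangle: "\<lbrakk>A \<in> Obj C; B \<in> Obj C\<rbrakk>
      \<Longrightarrow> (\<one> A \<odot> LUnit C B) \<cdot> Assoc C A (Unit C) B = RUnit C A \<odot> \<one> B"
    and Braid_Hom: "\<lbrakk>A \<in> Obj C; B \<in> Obj C\<rbrakk> \<Longrightarrow> Braid C A B \<in> Hom (A \<otimes> B) (B \<otimes> A)"
    and Braid_nat: "\<lbrakk>f \<in> Hom A A'; g \<in> Hom B B'\<rbrakk>
      \<Longrightarrow> Braid C A' B' \<cdot> (f \<odot> g) = (g \<odot> f) \<cdot> Braid C A B"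
    and Braid_sym: "\<lbrakk>A \<in> Obj C; B \<in> Obj C\<rbrakk> \<Longrightarrow> Braid C B A \<cdot> Braid C A B = \<one> (A \<otimes> B)"
    and Braid_Unit: "A \<in> Obj C \<Longrightarrow> LUnit C A \<cdot> Braid C A (Unit C) = RUnit C A"
    and hexagon: "\<lbrakk>A \<in> Obj C; B \<in> Obj C; D \<in> Obj C\<rbrakk>
      \<Longrightarrow> Assoc C B D A \<cdot> Braid C A (B \<otimes> D) \<cdot> Assoc C A B D
        = (\<one> B \<odot> Braid C A D) \<cdot> Assoc C B A D \<cdot> (Braid C A B \<odot> \<one> D)"

locale functor_between = C: category C + D: category D
  for C :: "('o, 'a, 'm) cat_scheme" and D :: "('p, 'b, 'n) cat_scheme" +
  fixes F :: "'o \<Rightarrow> 'p" and Fa :: "'a \<Rightarrow> 'b"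
  assumes F_Obj: "A \<in> Obj C \<Longrightarrow> F A \<in> Obj D"
    and Fa_Hom: "f \<in> Hom\<^bsub>C\<^esub> A B \<Longrightarrow> Fa f \<in> Hom\<^bsub>D\<^esub> (F A) (F B)"
    and Fa_Idn: "A \<in> Obj C \<Longrightarrow> Fa (\<one>\<^bsub>C\<^esub> A) = \<one>\<^bsub>D\<^esub> (F A)"
    and Fa_Comp: "\<lbrakk>f \<in> Hom\<^bsub>C\<^esub> A B; g \<in> Hom\<^bsub>C\<^esub> B E\<rbrakk> \<Longrightarrow> Fa (g \<cdot>\<^bsub>C\<^esub> f) = Fa g \<cdot>\<^bsub>D\<^esub> Fa f"

locale lax_symmetric_monoidal_functor =
  C: symmetric_monoidal_category C + D: symmetric_monoidal_category D + functor_between C D F Fa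
  for C :: "('o, 'a, 'm) moncat_scheme" and D :: "('p, 'b, 'n) moncat_scheme"
    and F :: "'o \<Rightarrow> 'p" and Fa :: "'a \<Rightarrow> 'b" +
  fixes \<mu> :: "'o \<Rightarrow> 'o \<Rightarrow> 'b" and \<epsilon> :: "'b"
  assumes mu_Hom: "\<lbrakk>A \<in> Obj C; B \<in> Obj C\<rbrakk> \<Longrightarrow> \<mu> A B \<in> Hom\<^bsub>D\<^esub> (F A \<otimes>\<^bsub>D\<^esub> F B) (F (A \<otimes>\<^bsub>C\<^esub> B))"
    and eps_Hom: "\<epsilon> \<in> Hom\<^bsub>D\<^esub> (Unit D) (F (Unit C))"
    and mu_nat: "\<lbrakk>f \<in> Hom\<^bsub>C\<^esub> A A'; g \<in> Hom\<^bsub>C\<^esub> B B'\<rbrakk>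
      \<Longrightarrow> \<mu> A' B' \<cdot>\<^bsub>D\<^esub> (Fa f \<odot>\<^bsub>D\<^esub> Fa g) = Fa (f \<odot>\<^bsub>C\<^esub> g) \<cdot>\<^bsub>D\<^esub> \<mu> A B"
    and lax_assoc: "\<lbrakk>A \<in> Obj C; B \<in> Obj C; E \<in> Obj C\<rbrakk>
      \<Longrightarrow> Fa (Assoc C A B E) \<cdot>\<^bsub>D\<^esub> \<mu> (A \<otimes>\<^bsub>C\<^esub> B) E \<cdot>\<^bsub>D\<^esub> (\<mu> A B \<odot>\<^bsub>D\<^esub> \<one>\<^bsub>D\<^esub> (F E))
        = \<mu> A (B \<otimes>\<^bsub>C\<^esub> E) \<cdot>\<^bsub>D\<^esub> (\<one>\<^bsub>D\<^esub> (F A) \<odot>\<^bsub>D\<^esub> \<mu> B E) \<cdot>\<^bsub>D\<^esub> Assoc D (F A) (F B) (F E)"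
    and lax_lunit: "A \<in> Obj C
      \<Longrightarrow> Fa (LUnit C A) \<cdot>\<^bsub>D\<^esub> \<mu> (Unit C) A \<cdot>\<^bsub>D\<^esub> (\<epsilon> \<odot>\<^bsub>D\<^esub> \<one>\<^bsub>D\<^esub> (F A)) = LUnit D (F A)"
    and lax_runit: "A \<in> Obj C
      \<Longrightarrow> Fa (RUnit C A) \<cdot>\<^bsub>D\<^esub> \<mu> A (Unit C) \<cdot>\<^bsub>D\<^esub> (\<one>\<^bsub>D\<^esub> (F A) \<odot>\<^bsub>D\<^esub> \<epsilon>) = RUnit D (F A)"
    and lax_sym: "\<lbrakk>A \<in> Obj C; B \<in> Obj C\<rbrakk>
      \<Longrightarrow> Fa (Braid C A B) \<cdot>\<^bsub>D\<^esub> \<mu> A B = \<mu> B A \<cdot>\<^bsub>D\<^esub> Braid D (F A) (F B)"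


section \<open>The categories of finite sets and of sets\<close>

text \<open>An arrow carries its source and target, and its underlying function is
  \<^const>\<open>undefined\<close> outside the source, so that equality of arrows is equality of maps.\<close>

datatype 'u mor = Mor (src: "'u set") (tgt: "'u set") (fn: "'u \<Rightarrow> 'u")

definition arrow :: "'u set \<Rightarrow> 'u set \<Rightarrow> ('u \<Rightarrow> 'u) \<Rightarrow> 'u mor" where
  "arrow A B f = Mor A B (restrict f A)"

definition is_map :: "'u mor \<Rightarrow> bool" where
  "is_map f \<longleftrightarrow> fn f \<in> src f \<rightarrow>\<^sub>E tgt f"

definition ident :: "'u set \<Rightarrow> 'u mor" where
  "ident A = arrow A A (\<lambda>x. x)"

definition mor_comp :: "'u mor \<Rightarrow> 'u mor \<Rightarrow> 'u mor" where
  "mor_comp g f = arrow (src f) (tgt g) (fn g \<circ> fn f)"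

text \<open>HOL has no set of all sets, so each category lives over a type of elements that is closed
  under the monoidal product. Finite sets are the finite subsets of \<open>'a elt\<close>; every finite set of
  elements of the arbitrary type \<open>'a\<close> occurs via \<open>Atom\<close>, and there are objects of every finite
  cardinality. The disjoint union is the tagged union.\<close>

datatype 'a elt = Atom 'a | InL "'a elt" | InR "'a elt"

definition dsum :: "'a elt set \<Rightarrow> 'a elt set \<Rightarrow> 'a elt set" where
  "dsum N M = InL ` N \<union> InR ` M"

definition dsum_map :: "'a elt mor \<Rightarrow> 'a elt mor \<Rightarrow> 'a elt mor" where
  "dsum_map f g = arrow (dsum (src f) (src g)) (dsum (tgt f) (tgt g))
     (\<lambda>z. case z of InL x \<Rightarrow> InL (fn f x) | InR y \<Rightarrow> InR (fn g y))"

definition dsum_assoc :: "'a elt set \<Rightarrow> 'a elt set \<Rightarrow> 'a elt set \<Rightarrow> 'a elt mor" where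
  "dsum_assoc N M K = arrow (dsum (dsum N M) K) (dsum N (dsum M K))
     (\<lambda>z. case z of InL (InL x) \<Rightarrow> InL x | InL (InR y) \<Rightarrow> InR (InL y) | InR w \<Rightarrow> InR (InR w))"

definition dsum_swap :: "'a elt set \<Rightarrow> 'a elt set \<Rightarrow> 'a elt mor" where
  "dsum_swap N M = arrow (dsum N M) (dsum M N) (\<lambda>z. case z of InL x \<Rightarrow> InR x | InR y \<Rightarrow> InL y)"

definition FinSet_plus :: "('a elt set, 'a elt mor) moncat" where
  "FinSet_plus = \<lparr>
     Obj = {N. finite N},
     Arr = {f. finite (src f) \<and> finite (tgt f) \<and> is_map f},
     Dom = src, Cod = tgt, Idn = ident, Comp = mor_comp,
     Tens = dsum, TensA = dsum_map, Unit = {}, Assoc = dsum_assoc,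
     LUnit = (\<lambda>N. arrow (dsum {} N) N (\<lambda>z. case z of InR x \<Rightarrow> x)),
     RUnit = (\<lambda>N. arrow (dsum N {}) N (\<lambda>z. case z of InL x \<Rightarrow> x)),
     Braid = dsum_swap \<rparr>"

text \<open>Sets are arbitrary subsets of \<open>'b tup\<close>; every set of elements of the arbitrary type \<open>'b\<close>
  occurs via \<open>Elem\<close>. The constructor \<open>Pr\<close> forms ordered pairs.\<close>

datatype 'b tup = Elem 'b | Star | Pr "'b tup" "'b tup"

definition cprod :: "'b tup set \<Rightarrow> 'b tup set \<Rightarrow> 'b tup set" where
  "cprod A B = {Pr a b | a b. a \<in> A \<and> b \<in> B}"

definition cprod_map :: "'b tup mor \<Rightarrow> 'b tup mor \<Rightarrow> 'b tup mor" where
  "cprod_map f g = arrow (cprod (src f) (src g)) (cprod (tgt f) (tgt g))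
     (\<lambda>z. case z of Pr a b \<Rightarrow> Pr (fn f a) (fn g b))"

definition cprod_assoc :: "'b tup set \<Rightarrow> 'b tup set \<Rightarrow> 'b tup set \<Rightarrow> 'b tup mor" where
  "cprod_assoc A B D = arrow (cprod (cprod A B) D) (cprod A (cprod B D))
     (\<lambda>z. case z of Pr (Pr a b) d \<Rightarrow> Pr a (Pr b d))"

definition cprod_swap :: "'b tup set \<Rightarrow> 'b tup set \<Rightarrow> 'b tup mor" where
  "cprod_swap A B = arrow (cprod A B) (cprod B A) (\<lambda>z. case z of Pr a b \<Rightarrow> Pr b a)"

definition Set_times :: "('b tup set, 'b tup mor) moncat" where
  "Set_times = \<lparr>
     Obj = UNIV,
     Arr = {f. is_map f},
     Dom = src, Cod = tgt, Idn = ident, Comp = mor_comp,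
     Tens = cprod, TensA = cprod_map, Unit = {Star}, Assoc = cprod_assoc,
     LUnit = (\<lambda>A. arrow (cprod {Star} A) A (\<lambda>z. case z of Pr _ a \<Rightarrow> a)),
     RUnit = (\<lambda>A. arrow (cprod A {Star}) A (\<lambda>z. case z of Pr a _ \<Rightarrow> a)),
     Braid = cprod_swap \<rparr>"


section \<open>Nondeterministic dynamics\<close>

text \<open>A vector in \<open>\<real>\<^sup>N\<close> is a real function on \<open>N\<close>, \<^const>\<open>undefined\<close> outside \<open>N\<close>;
  likewise for functions on \<open>\<real>\<^sup>N\<close>.\<close>

type_synonym 'a vec = "'a elt \<Rightarrow> real"
type_synonym 'a dyn = "'a vec \<Rightarrow> 'a vec set"

definition Rpow :: "'a elt set \<Rightarrow> 'a vec set" where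
  "Rpow N = N \<rightarrow>\<^sub>E UNIV"

definition pullback :: "'a elt mor \<Rightarrow> 'a vec \<Rightarrow> 'a vec" where
  "pullback \<phi> y = (\<lambda>i\<in>src \<phi>. y (fn \<phi> i))"

definition pushforward :: "'a elt mor \<Rightarrow> 'a vec \<Rightarrow> 'a vec" where
  "pushforward \<phi> x = (\<lambda>j\<in>tgt \<phi>. \<Sum>i\<in>{i \<in> src \<phi>. fn \<phi> i = j}. x i)"

definition dyns :: "'a elt set \<Rightarrow> 'a dyn set" where
  "dyns N = Rpow N \<rightarrow>\<^sub>E Pow (Rpow N)"

definition dyn_map :: "'a elt mor \<Rightarrow> 'a dyn \<Rightarrow> 'a dyn" where
  "dyn_map \<phi> \<upsilon> = (\<lambda>y\<in>Rpow (tgt \<phi>). pushforward \<phi> ` \<upsilon> (pullback \<phi> y))"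

definition minkowski :: "'a elt set \<Rightarrow> 'a vec set \<Rightarrow> 'a vec set \<Rightarrow> 'a vec set" where
  "minkowski N A B = {(\<lambda>i\<in>N. a i + b i) | a b. a \<in> A \<and> b \<in> B}"

definition incl_left :: "'a elt set \<Rightarrow> 'a elt set \<Rightarrow> 'a elt mor" where
  "incl_left N M = arrow N (dsum N M) InL"

definition incl_right :: "'a elt set \<Rightarrow> 'a elt set \<Rightarrow> 'a elt mor" where
  "incl_right N M = arrow M (dsum N M) InR"

text \<open>Here \<open>dyn_map \<iota>\<close> is \<open>P\<iota>\<^sub>* \<circ> _ \<circ> \<iota>\<^sup>*\<close> for the inclusions \<open>\<iota>\<close> of the two summands.\<close>

definition dyn_sum :: "'a elt set \<Rightarrow> 'a elt set \<Rightarrow> 'a dyn \<Rightarrow> 'a dyn \<Rightarrow> 'a dyn" where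
  "dyn_sum N M \<upsilon> \<rho> = (\<lambda>z\<in>Rpow (dsum N M).
     minkowski (dsum N M) (dyn_map (incl_left N M) \<upsilon> z) (dyn_map (incl_right N M) \<rho> z))"

text \<open>Elements of \<open>NDD N\<close> are maps \<open>\<upsilon>\<close> on \<open>\<real>\<^sup>N\<close>, injected by \<open>mk_dyn\<close> into the elements of the
  category of sets; the arbitrary type \<open>'c\<close> only enlarges the latter category.\<close>

definition mk_dyn :: "'a dyn \<Rightarrow> ('a dyn + 'c) tup" where
  "mk_dyn \<upsilon> = Elem (Inl \<upsilon>)"

definition NDD :: "'a elt set \<Rightarrow> ('a dyn + 'c) tup set" where
  "NDD N = mk_dyn ` dyns N"

definition NDD_map :: "'a elt mor \<Rightarrow> ('a dyn + 'c) tup mor" where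
  "NDD_map \<phi> = arrow (NDD (src \<phi>)) (NDD (tgt \<phi>))
     (\<lambda>p. case p of Elem (Inl \<upsilon>) \<Rightarrow> mk_dyn (dyn_map \<phi> \<upsilon>))"

definition NDD_prod :: "'a elt set \<Rightarrow> 'a elt set \<Rightarrow> ('a dyn + 'c) tup mor" where
  "NDD_prod N M = arrow (cprod (NDD N) (NDD M)) (NDD (dsum N M))
     (\<lambda>p. case p of Pr (Elem (Inl \<upsilon>)) (Elem (Inl \<rho>)) \<Rightarrow> mk_dyn (dyn_sum N M \<upsilon> \<rho>))"

definition NDD_unit :: "('a dyn + 'c) tup mor" where
  "NDD_unit = arrow {Star} (NDD {}) (\<lambda>_. mk_dyn (\<lambda>x\<in>Rpow {}. {\<lambda>i\<in>{}. 0}))"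

end

theory Submission
  imports Defs
begin

text \<open>
  A vector on \<open>N + M\<close> is the same as a pair of vectors \<open>(a, b)\<close> on \<open>N\<close> and \<open>M\<close>, and
  \<open>\<iota>\<^sub>N\<^sub>*(a) + \<iota>\<^sub>M\<^sub>*(b)\<close> is the vector \<open>vjoin N M a b\<close> that corresponds to the pair: extension by
  zero makes the two summands supported on complementary parts. The Minkowski sum in the product
  comparison is therefore a Cartesian product in disguise (\<open>dyn_sum_apply\<close>):
  \<open>\<phi>\<^sub>N\<^sub>,\<^sub>M(\<upsilon>, \<rho>)(z)\<close> consists of all joins of an element of \<open>\<upsilon>(z|\<^sub>N)\<close> with an element of
  \<open>\<rho>(z|\<^sub>M)\<close>.

  In this form each axiom splits into a statement about the argument \<open>z\<close> and one about the joined
  vectors. On arguments, pullback is contravariantly functorial, and restriction to a summand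
  commutes with it because the inclusions are natural. On values, pushforward is covariantly
  functorial, because the fibres of a composite are disjoint unions of fibres
  (\<open>pushforward_mor_comp\<close>); it acts on a join componentwise along a disjoint union of maps
  (\<open>pushforward_dsum_map_vjoin\<close>); and along the coherence bijections it regroups, swaps or drops
  components. The last point holds because pushforward along a bijection is inverse to pullback
  along it (\<open>pushforward_pullback\<close>), and the effect of pullback on a join is visible pointwise.
  These facts about vectors give \<open>dyn_map_mor_comp\<close>, \<open>dyn_sum_natural\<close>, \<open>dyn_sum_assoc\<close>,
  \<open>dyn_sum_swap\<close> and the two unit laws, which are the axioms evaluated at elements. The coherence
  laws of the two base categories are checked elementwise as well.
\<close>

section \<open>Equality of maps between sets\<close>

lemma mor_eqI:
  assumes "src f = src g" "tgt f = tgt g"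
    and "fn f \<in> extensional (src f)" "fn g \<in> extensional (src g)"
    and "\<And>x. x \<in> src f \<Longrightarrow> fn f x = fn g x"
  shows "f = g"
  using assms by (intro mor.expand) (auto intro: extensionalityI)

text \<open>The extensionality clause here, as for the other arrows below, leaves the domain open up to a
  side condition: the simplifier computes sources first, so that the domain seldom appears in the
  form in which it arises.\<close>

lemma arrow_simps [simp]:
  "src (arrow A B f) = A" "tgt (arrow A B f) = B"
  "x \<in> A \<Longrightarrow> fn (arrow A B f) x = f x"
  "A = A' \<Longrightarrow> fn (arrow A B f) \<in> extensional A'"
  by (simp_all add: arrow_def)

lemma is_map_arrow [simp]: "is_map (arrow A B f) \<longleftrightarrow> f \<in> A \<rightarrow> B"
  by (auto simp: is_map_def arrow_def PiE_iff)

lemma is_map_apply: "is_map f \<Longrightarrow> tgt f = B \<Longrightarrow> x \<in> src f \<Longrightarrow> fn f x \<in> B"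
  by (auto simp: is_map_def)

lemma is_map_extensional: "is_map f \<Longrightarrow> src f = A \<Longrightarrow> fn f \<in> extensional A"
  by (auto simp: is_map_def PiE_iff)

lemma mor_comp_simps [simp]:
  "src (mor_comp g f) = src f" "tgt (mor_comp g f) = tgt g"
  "x \<in> src f \<Longrightarrow> fn (mor_comp g f) x = fn g (fn f x)"
  "src f = A \<Longrightarrow> fn (mor_comp g f) \<in> extensional A"
  by (simp_all add: mor_comp_def)

lemma is_map_mor_comp: "is_map f \<Longrightarrow> is_map g \<Longrightarrow> tgt f = src g \<Longrightarrow> is_map (mor_comp g f)"
  by (auto simp: mor_comp_def) (metis is_map_apply)

lemma ident_simps [simp]:
  "src (ident A) = A" "tgt (ident A) = A" "x \<in> A \<Longrightarrow> fn (ident A) x = x"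
  "A = A' \<Longrightarrow> fn (ident A) \<in> extensional A'" "is_map (ident A)"
  by (simp_all add: ident_def)

text \<open>Both base categories are full subcategories of sets over some type of elements, so the
  category axioms need only one verification.\<close>

lemma category_of_sets:
  assumes "Dom C = src" "Cod C = tgt" "Idn C = ident" "Comp C = mor_comp"
    and "Arr C = {f. src f \<in> Obj C \<and> tgt f \<in> Obj C \<and> is_map f}"
  shows "category C"
  by unfold_locales
    (use assms in \<open>auto simp: Hom_def is_map_mor_comp is_map_apply is_map_extensional
       intro!: mor_eqI\<close>)

text \<open>The inverse in the category is the set-theoretic inverse, restricted to the target.\<close>

lemma Iso_of_sets:
  assumes "Dom C = src" "Cod C = tgt" "Idn C = ident" "Comp C = mor_comp"
    and "Arr C = {f. src f \<in> Obj C \<and> tgt f \<in> Obj C \<and> is_map f}"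
    and "A \<in> Obj C" "B \<in> Obj C"
    and f: "src f = A" "tgt f = B" "is_map f" "bij_betw (fn f) A B"
  shows "f \<in> Iso\<^bsub>C\<^esub> A B"
proof -
  let ?g = "arrow B A (inv_into A (fn f))"
  have "?g \<in> Hom\<^bsub>C\<^esub> B A" "f \<in> Hom\<^bsub>C\<^esub> A B"
    using assms by (auto simp: Hom_def bij_betw_def intro: inv_into_into)
  moreover have "mor_comp ?g f = ident A" "mor_comp f ?g = ident B"
    using f by (auto intro!: mor_eqI simp: is_map_apply bij_betw_inv_into_left
        bij_betw_inv_into_right)
  ultimately show ?thesis
    using assms by (auto simp: Iso_def)
qed

section \<open>Finite sets under disjoint union\<close>

lemma dsum_iff [simp]:
  "InL x \<in> dsum N M \<longleftrightarrow> x \<in> N" "InR y \<in> dsum N M \<longleftrightarrow> y \<in> M" "Atom a \<notin> dsum N M"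
  by (auto simp: dsum_def)

lemma dsumE:
  assumes "z \<in> dsum N M"
  obtains x where "z = InL x" "x \<in> N" | y where "z = InR y" "y \<in> M"
  using assms by (auto simp: dsum_def)

lemma finite_dsum [simp]: "finite N \<Longrightarrow> finite M \<Longrightarrow> finite (dsum N M)"
  by (simp add: dsum_def)

lemma dsum_map_simps [simp]:
  "src (dsum_map f g) = dsum (src f) (src g)" "tgt (dsum_map f g) = dsum (tgt f) (tgt g)"
  "x \<in> src f \<Longrightarrow> fn (dsum_map f g) (InL x) = InL (fn f x)"
  "y \<in> src g \<Longrightarrow> fn (dsum_map f g) (InR y) = InR (fn g y)"
  "dsum (src f) (src g) = A \<Longrightarrow> fn (dsum_map f g) \<in> extensional A"
  by (simp_all add: dsum_map_def)

lemma is_map_dsum_map: "is_map f \<Longrightarrow> is_map g \<Longrightarrow> is_map (dsum_map f g)"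
  by (auto simp: dsum_map_def is_map_apply elim!: dsumE)

lemma dsum_assoc_simps [simp]:
  "src (dsum_assoc N M K) = dsum (dsum N M) K" "tgt (dsum_assoc N M K) = dsum N (dsum M K)"
  "x \<in> N \<Longrightarrow> fn (dsum_assoc N M K) (InL (InL x)) = InL x"
  "y \<in> M \<Longrightarrow> fn (dsum_assoc N M K) (InL (InR y)) = InR (InL y)"
  "w \<in> K \<Longrightarrow> fn (dsum_assoc N M K) (InR w) = InR (InR w)"
  "fn (dsum_assoc N M K) \<in> extensional (dsum (dsum N M) K)"
  "is_map (dsum_assoc N M K)"
  by (auto simp: dsum_assoc_def elim!: dsumE)

lemma dsum_swap_simps [simp]:
  "src (dsum_swap N M) = dsum N M" "tgt (dsum_swap N M) = dsum M N"
  "x \<in> N \<Longrightarrow> fn (dsum_swap N M) (InL x) = InR x"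
  "y \<in> M \<Longrightarrow> fn (dsum_swap N M) (InR y) = InL y"
  "fn (dsum_swap N M) \<in> extensional (dsum N M)"
  "is_map (dsum_swap N M)"
  by (auto simp: dsum_swap_def elim!: dsumE)

lemma FinSet_plus_simps [simp]:
  "Obj FinSet_plus = {N. finite N}"
  "Arr FinSet_plus = {f. finite (src f) \<and> finite (tgt f) \<and> is_map f}"
  "Dom FinSet_plus = src" "Cod FinSet_plus = tgt"
  "Idn FinSet_plus = ident" "Comp FinSet_plus = mor_comp"
  "Tens FinSet_plus = dsum" "TensA FinSet_plus = dsum_map" "Unit FinSet_plus = {}"
  "Assoc FinSet_plus = dsum_assoc"
  "LUnit FinSet_plus N = arrow (dsum {} N) N (\<lambda>z. case z of InR x \<Rightarrow> x)"
  "RUnit FinSet_plus N = arrow (dsum N {}) N (\<lambda>z. case z of InL x \<Rightarrow> x)"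
  "Braid FinSet_plus = dsum_swap"
  by (simp_all add: FinSet_plus_def)

lemma Hom_FinSet_plus:
  "f \<in> Hom\<^bsub>FinSet_plus\<^esub> A B \<longleftrightarrow> src f = A \<and> tgt f = B \<and> finite A \<and> finite B \<and> is_map f"
  by (auto simp: Hom_def)

lemma bij_betw_dsum_assoc:
  "bij_betw (fn (dsum_assoc N M K)) (dsum (dsum N M) K) (dsum N (dsum M K))"
  by (rule bij_betwI[where g = "fn (arrow (dsum N (dsum M K)) (dsum (dsum N M) K)
        (\<lambda>z. case z of InL x \<Rightarrow> InL (InL x) | InR (InL y) \<Rightarrow> InL (InR y) | InR (InR w) \<Rightarrow> InR w))"])
    (auto elim!: dsumE)

lemma bij_betw_dsum_swap: "bij_betw (fn (dsum_swap N M)) (dsum N M) (dsum M N)"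
  by (rule bij_betwI[where g = "fn (dsum_swap M N)"]) (auto elim!: dsumE)

lemma bij_betw_dsum_lunit:
  "bij_betw (fn (arrow (dsum {} N) N (\<lambda>z. case z of InR x \<Rightarrow> x))) (dsum {} N) N"
  by (rule bij_betwI[where g = InR]) (auto elim!: dsumE)

lemma bij_betw_dsum_runit:
  "bij_betw (fn (arrow (dsum N {}) N (\<lambda>z. case z of InL x \<Rightarrow> x))) (dsum N {}) N"
  by (rule bij_betwI[where g = InL]) (auto elim!: dsumE)

lemma symmetric_monoidal_FinSet_plus:
  "symmetric_monoidal_category (FinSet_plus :: ('a elt set, 'a elt mor) moncat)"
proof -
  interpret category "FinSet_plus :: ('a elt set, 'a elt mor) moncat"
    by (rule category_of_sets) auto
  show ?thesis
    apply unfold_locales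
    subgoal by simp
    subgoal by simp
    subgoal by (auto simp: Hom_FinSet_plus is_map_dsum_map)
    subgoal by (auto intro!: mor_eqI elim!: dsumE)
    subgoal by (auto simp: Hom_FinSet_plus is_map_apply intro!: mor_eqI elim!: dsumE)
    subgoal by (rule Iso_of_sets) (simp_all add: bij_betw_dsum_assoc)
    subgoal by (auto simp: Hom_FinSet_plus is_map_apply intro!: mor_eqI elim!: dsumE)
    subgoal by (rule Iso_of_sets) (auto simp: bij_betw_dsum_lunit bij_betw_dsum_runit elim!: dsumE)
    subgoal by (auto simp: Hom_FinSet_plus is_map_apply intro!: mor_eqI elim!: dsumE)
    subgoal by (rule Iso_of_sets) (auto simp: bij_betw_dsum_lunit bij_betw_dsum_runit elim!: dsumE)
    subgoal by (auto simp: Hom_FinSet_plus is_map_apply intro!: mor_eqI elim!: dsumE)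
    subgoal by (auto intro!: mor_eqI elim!: dsumE)
    subgoal by (auto intro!: mor_eqI elim!: dsumE)
    subgoal by (auto simp: Hom_FinSet_plus)
    subgoal by (auto simp: Hom_FinSet_plus is_map_apply intro!: mor_eqI elim!: dsumE)
    subgoal by (auto intro!: mor_eqI elim!: dsumE)
    subgoal by (auto intro!: mor_eqI elim!: dsumE)
    subgoal by (auto intro!: mor_eqI elim!: dsumE)
    done
qed

section \<open>Sets under Cartesian product\<close>

lemma cprod_iff [simp]: "Pr a b \<in> cprod A B \<longleftrightarrow> a \<in> A \<and> b \<in> B"
  by (auto simp: cprod_def)

lemma cprodE:
  assumes "z \<in> cprod A B"
  obtains a b where "z = Pr a b" "a \<in> A" "b \<in> B"
  using assms by (auto simp: cprod_def)

lemma cprod_map_simps [simp]: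
  "src (cprod_map f g) = cprod (src f) (src g)" "tgt (cprod_map f g) = cprod (tgt f) (tgt g)"
  "a \<in> src f \<Longrightarrow> b \<in> src g \<Longrightarrow> fn (cprod_map f g) (Pr a b) = Pr (fn f a) (fn g b)"
  "cprod (src f) (src g) = A \<Longrightarrow> fn (cprod_map f g) \<in> extensional A"
  by (simp_all add: cprod_map_def)

lemma is_map_cprod_map: "is_map f \<Longrightarrow> is_map g \<Longrightarrow> is_map (cprod_map f g)"
  by (auto simp: cprod_map_def is_map_apply elim!: cprodE)

lemma cprod_assoc_simps [simp]:
  "src (cprod_assoc A B D) = cprod (cprod A B) D" "tgt (cprod_assoc A B D) = cprod A (cprod B D)"
  "a \<in> A \<Longrightarrow> b \<in> B \<Longrightarrow> d \<in> D \<Longrightarrow> fn (cprod_assoc A B D) (Pr (Pr a b) d) = Pr a (Pr b d)"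
  "fn (cprod_assoc A B D) \<in> extensional (cprod (cprod A B) D)"
  "is_map (cprod_assoc A B D)"
  by (auto simp: cprod_assoc_def elim!: cprodE)

lemma cprod_swap_simps [simp]:
  "src (cprod_swap A B) = cprod A B" "tgt (cprod_swap A B) = cprod B A"
  "a \<in> A \<Longrightarrow> b \<in> B \<Longrightarrow> fn (cprod_swap A B) (Pr a b) = Pr b a"
  "fn (cprod_swap A B) \<in> extensional (cprod A B)"
  "is_map (cprod_swap A B)"
  by (auto simp: cprod_swap_def elim!: cprodE)

lemma Set_times_simps [simp]:
  "Obj Set_times = UNIV" "Arr Set_times = {f. is_map f}"
  "Dom Set_times = src" "Cod Set_times = tgt"
  "Idn Set_times = ident" "Comp Set_times = mor_comp"
  "Tens Set_times = cprod" "TensA Set_times = cprod_map" "Unit Set_times = {Star}"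
  "Assoc Set_times = cprod_assoc"
  "LUnit Set_times A = arrow (cprod {Star} A) A (\<lambda>z. case z of Pr _ a \<Rightarrow> a)"
  "RUnit Set_times A = arrow (cprod A {Star}) A (\<lambda>z. case z of Pr a _ \<Rightarrow> a)"
  "Braid Set_times = cprod_swap"
  by (simp_all add: Set_times_def)

lemma Hom_Set_times: "f \<in> Hom\<^bsub>Set_times\<^esub> A B \<longleftrightarrow> src f = A \<and> tgt f = B \<and> is_map f"
  by (auto simp: Hom_def)

lemma bij_betw_cprod_assoc:
  "bij_betw (fn (cprod_assoc A B D)) (cprod (cprod A B) D) (cprod A (cprod B D))"
  by (rule bij_betwI[where g = "\<lambda>z. case z of Pr a (Pr b d) \<Rightarrow> Pr (Pr a b) d"])
    (auto elim!: cprodE)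

lemma symmetric_monoidal_Set_times:
  "symmetric_monoidal_category (Set_times :: ('b tup set, 'b tup mor) moncat)"
proof -
  interpret category "Set_times :: ('b tup set, 'b tup mor) moncat"
    by (rule category_of_sets) auto
  have unitors:
    "bij_betw (fn (arrow (cprod {Star} A) A (\<lambda>z. case z of Pr _ a \<Rightarrow> a))) (cprod {Star} A) A"
    "bij_betw (fn (arrow (cprod A {Star}) A (\<lambda>z. case z of Pr a _ \<Rightarrow> a))) (cprod A {Star}) A"
    for A :: "'b tup set"
    by (rule bij_betwI[where g = "Pr Star"], auto elim!: cprodE)
      (rule bij_betwI[where g = "\<lambda>a. Pr a Star"], auto elim!: cprodE)
  show ?thesis
    apply unfold_locales
    subgoal by simp
    subgoal by simp
    subgoal by (auto simp: Hom_Set_times is_map_cprod_map)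
    subgoal by (auto intro!: mor_eqI elim!: cprodE)
    subgoal by (auto simp: Hom_Set_times is_map_apply intro!: mor_eqI elim!: cprodE)
    subgoal by (rule Iso_of_sets) (simp_all add: bij_betw_cprod_assoc)
    subgoal by (auto simp: Hom_Set_times is_map_apply intro!: mor_eqI elim!: cprodE)
    subgoal by (rule Iso_of_sets) (auto simp: unitors elim!: cprodE)
    subgoal by (auto simp: Hom_Set_times is_map_apply intro!: mor_eqI elim!: cprodE)
    subgoal by (rule Iso_of_sets) (auto simp: unitors elim!: cprodE)
    subgoal by (auto simp: Hom_Set_times is_map_apply intro!: mor_eqI elim!: cprodE)
    subgoal by (auto intro!: mor_eqI elim!: cprodE)
    subgoal by (auto intro!: mor_eqI elim!: cprodE)
    subgoal by (auto simp: Hom_Set_times)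
    subgoal by (auto simp: Hom_Set_times is_map_apply intro!: mor_eqI elim!: cprodE)
    subgoal by (auto intro!: mor_eqI elim!: cprodE)
    subgoal by (auto intro!: mor_eqI elim!: cprodE)
    subgoal by (auto intro!: mor_eqI elim!: cprodE)
    done
qed

section \<open>Pullback and pushforward of vectors\<close>

lemma vec_eqI: "x \<in> Rpow N \<Longrightarrow> y \<in> Rpow N \<Longrightarrow> (\<And>i. i \<in> N \<Longrightarrow> x i = y i) \<Longrightarrow> x = y"
  by (auto simp: Rpow_def intro: PiE_ext)

lemma pullback_Rpow [simp]: "src \<phi> = N \<Longrightarrow> pullback \<phi> y \<in> Rpow N"
  by (auto simp: pullback_def Rpow_def)

lemma pushforward_Rpow [simp]: "tgt \<phi> = M \<Longrightarrow> pushforward \<phi> x \<in> Rpow M"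
  by (auto simp: pushforward_def Rpow_def)

lemma pullback_apply [simp]: "i \<in> src \<phi> \<Longrightarrow> pullback \<phi> y i = y (fn \<phi> i)"
  by (simp add: pullback_def)

lemma pullback_ident: "y \<in> Rpow N \<Longrightarrow> pullback (ident N) y = y"
  by (rule vec_eqI[of _ N]) auto

lemma pullback_mor_comp:
  assumes "is_map \<phi>" "tgt \<phi> = src \<psi>"
  shows "pullback (mor_comp \<psi> \<phi>) y = pullback \<phi> (pullback \<psi> y)"
  by (rule vec_eqI[of _ "src \<phi>"]) (use assms is_map_apply in force)+

text \<open>The fibre over the image of an injective map is a single point.\<close>

lemma pushforward_inj:
  assumes "inj_on (fn \<phi>) (src \<phi>)" "i \<in> src \<phi>" "fn \<phi> i \<in> tgt \<phi>"
  shows "pushforward \<phi> x (fn \<phi> i) = x i"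
proof -
  have "{k \<in> src \<phi>. fn \<phi> k = fn \<phi> i} = {i}"
    using assms by (auto dest: inj_onD)
  then show ?thesis
    using assms by (simp add: pushforward_def)
qed

text \<open>On a bijection each fibre sum has one term, so pushforward only renames coordinates. This reduces
  computing a pushforward along a coherence isomorphism to recognising its argument as a pullback,
  which can be done coordinate by coordinate.\<close>

lemma pushforward_pullback:
  assumes bij: "bij_betw (fn \<phi>) (src \<phi>) (tgt \<phi>)" and y: "y \<in> Rpow (tgt \<phi>)"
  shows "pushforward \<phi> (pullback \<phi> y) = y"
proof (rule vec_eqI[of _ "tgt \<phi>"])
  fix j assume "j \<in> tgt \<phi>"
  then obtain i where "i \<in> src \<phi>" "j = fn \<phi> i"
    using bij by (auto simp: bij_betw_def)
  then show "pushforward \<phi> (pullback \<phi> y) j = y j"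
    using bij \<open>j \<in> tgt \<phi>\<close> by (simp add: pushforward_inj bij_betw_def)
qed (simp_all add: y)

lemma pushforward_ident: "x \<in> Rpow N \<Longrightarrow> pushforward (ident N) x = x"
  using pushforward_pullback[of "ident N" x] by (simp add: pullback_ident bij_betw_def inj_on_def)

text \<open>The fibre of a composite over \<open>k\<close> is partitioned by the fibres of the first map.\<close>

lemma pushforward_mor_comp:
  assumes "finite (src \<phi>)" "finite (tgt \<phi>)" "is_map \<phi>" "tgt \<phi> = src \<psi>"
  shows "pushforward (mor_comp \<psi> \<phi>) x = pushforward \<psi> (pushforward \<phi> x)"
proof (rule vec_eqI[of _ "tgt \<psi>"])
  fix k assume k: "k \<in> tgt \<psi>"
  let ?S = "{i \<in> src \<phi>. fn \<psi> (fn \<phi> i) = k}" and ?T = "{j \<in> src \<psi>. fn \<psi> j = k}"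
  have "(\<Sum>i\<in>?S. x i) = (\<Sum>j\<in>?T. \<Sum>i\<in>{i \<in> ?S. fn \<phi> i = j}. x i)"
    using assms by (intro sum.group[symmetric]) (auto dest: is_map_apply)
  also have "\<dots> = (\<Sum>j\<in>?T. \<Sum>i\<in>{i \<in> src \<phi>. fn \<phi> i = j}. x i)"
    by (intro sum.cong) auto
  finally show "pushforward (mor_comp \<psi> \<phi>) x k = pushforward \<psi> (pushforward \<phi> x) k"
    using k assms(4) by (simp add: pushforward_def cong: conj_cong)
qed auto

section \<open>Vectors on a disjoint union\<close>

text \<open>The vector on \<open>N + M\<close> with components \<open>a\<close> and \<open>b\<close> under the isomorphism
  \<open>\<real>\<^sup>N\<^sup>+\<^sup>M \<cong> \<real>\<^sup>N \<times> \<real>\<^sup>M\<close>.\<close>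

definition vjoin :: "'a elt set \<Rightarrow> 'a elt set \<Rightarrow> 'a vec \<Rightarrow> 'a vec \<Rightarrow> 'a vec" where
  "vjoin N M a b = (\<lambda>z\<in>dsum N M. case z of InL x \<Rightarrow> a x | InR y \<Rightarrow> b y)"

lemma vjoin_apply [simp]:
  "x \<in> N \<Longrightarrow> vjoin N M a b (InL x) = a x" "y \<in> M \<Longrightarrow> vjoin N M a b (InR y) = b y"
  by (simp_all add: vjoin_def)

lemma vjoin_Rpow [simp]: "vjoin N M a b \<in> Rpow (dsum N M)"
  by (auto simp: vjoin_def Rpow_def)

lemma incl_simps [simp]:
  "src (incl_left N M) = N" "tgt (incl_left N M) = dsum N M"
  "x \<in> N \<Longrightarrow> fn (incl_left N M) x = InL x"
  "src (incl_right N M) = M" "tgt (incl_right N M) = dsum N M"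
  "y \<in> M \<Longrightarrow> fn (incl_right N M) y = InR y"
  by (simp_all add: incl_left_def incl_right_def)

lemma pushforward_incl_left [simp]:
  "x \<in> N \<Longrightarrow> pushforward (incl_left N M) a (InL x) = a x"
  "y \<in> M \<Longrightarrow> pushforward (incl_left N M) a (InR y) = 0"
  using pushforward_inj[of "incl_left N M" x a]
  by (auto simp: inj_on_def pushforward_def cong: conj_cong)

lemma pushforward_incl_right [simp]:
  "y \<in> M \<Longrightarrow> pushforward (incl_right N M) b (InR y) = b y"
  "x \<in> N \<Longrightarrow> pushforward (incl_right N M) b (InL x) = 0"
  using pushforward_inj[of "incl_right N M" y b]
  by (auto simp: inj_on_def pushforward_def cong: conj_cong)

text \<open>Each coordinate of the sum has a summand that vanishes, since \<open>\<iota>\<^sub>N\<close> and \<open>\<iota>\<^sub>M\<close> have disjoint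
  images. This is what turns Minkowski sums into sets of joins.\<close>

lemma vjoin_eq_sum:
  "(\<lambda>i\<in>dsum N M. pushforward (incl_left N M) a i + pushforward (incl_right N M) b i)
    = vjoin N M a b"
  by (rule vec_eqI[of _ "dsum N M"]) (auto simp: Rpow_def vjoin_def elim!: dsumE)

text \<open>The fibre of \<open>f + g\<close> over a point of one summand lies entirely in the corresponding summand of
  the source.\<close>

lemma pushforward_dsum_map_vjoin:
  "pushforward (dsum_map f g) (vjoin (src f) (src g) a b)
    = vjoin (tgt f) (tgt g) (pushforward f a) (pushforward g b)"
proof (rule vec_eqI[of _ "dsum (tgt f) (tgt g)"])
  fix z assume "z \<in> dsum (tgt f) (tgt g)"
  then show "pushforward (dsum_map f g) (vjoin (src f) (src g) a b) z
    = vjoin (tgt f) (tgt g) (pushforward f a) (pushforward g b) z"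
  proof (cases rule: dsumE)
    case (1 j)
    have "{i \<in> dsum (src f) (src g). fn (dsum_map f g) i = InL j} = InL ` {i \<in> src f. fn f i = j}"
      by (auto elim!: dsumE)
    with 1 show ?thesis
      by (auto simp: pushforward_def sum.reindex inj_on_def intro!: sum.cong)
  next
    case (2 j)
    have "{i \<in> dsum (src f) (src g). fn (dsum_map f g) i = InR j} = InR ` {i \<in> src g. fn g i = j}"
      by (auto elim!: dsumE)
    with 2 show ?thesis
      by (auto simp: pushforward_def sum.reindex inj_on_def intro!: sum.cong)
  qed
qed auto

lemma pushforward_assoc_vjoin:
  "pushforward (dsum_assoc N M K) (vjoin (dsum N M) K (vjoin N M a b) c)
    = vjoin N (dsum M K) a (vjoin M K b c)"
proof -
  have "vjoin (dsum N M) K (vjoin N M a b) c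
      = pullback (dsum_assoc N M K) (vjoin N (dsum M K) a (vjoin M K b c))"
    by (rule vec_eqI[of _ "dsum (dsum N M) K"]) (auto elim!: dsumE)
  then show ?thesis
    by (simp add: pushforward_pullback bij_betw_dsum_assoc)
qed

lemma pushforward_swap_vjoin:
  "pushforward (dsum_swap N M) (vjoin N M a b) = vjoin M N b a"
proof -
  have "vjoin N M a b = pullback (dsum_swap N M) (vjoin M N b a)"
    by (rule vec_eqI[of _ "dsum N M"]) (auto elim!: dsumE)
  then show ?thesis
    by (simp add: pushforward_pullback bij_betw_dsum_swap)
qed

lemma pushforward_lunit_vjoin:
  assumes "b \<in> Rpow N"
  shows "pushforward (arrow (dsum {} N) N (\<lambda>z. case z of InR x \<Rightarrow> x)) (vjoin {} N a b) = b"
    (is "pushforward ?l _ = _")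
proof -
  have "vjoin {} N a b = pullback ?l b"
    by (rule vec_eqI[of _ "dsum {} N"]) (auto elim!: dsumE)
  then show ?thesis
    by (simp add: pushforward_pullback bij_betw_dsum_lunit assms)
qed

lemma pushforward_runit_vjoin:
  assumes "a \<in> Rpow N"
  shows "pushforward (arrow (dsum N {}) N (\<lambda>z. case z of InL x \<Rightarrow> x)) (vjoin N {} a b) = a"
    (is "pushforward ?r _ = _")
proof -
  have "vjoin N {} a b = pullback ?r a"
    by (rule vec_eqI[of _ "dsum N {}"]) (auto elim!: dsumE)
  then show ?thesis
    by (simp add: pushforward_pullback bij_betw_dsum_runit assms)
qed

section \<open>Transport and sum of dynamics\<close>

lemma dyns_eqI:
  "\<upsilon> \<in> dyns N \<Longrightarrow> \<rho> \<in> dyns N \<Longrightarrow> (\<And>y. y \<in> Rpow N \<Longrightarrow> \<upsilon> y = \<rho> y) \<Longrightarrow> \<upsilon> = \<rho>"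
  unfolding dyns_def by (rule PiE_ext)

lemma dyns_vec: "\<upsilon> \<in> dyns N \<Longrightarrow> y \<in> Rpow N \<Longrightarrow> x \<in> \<upsilon> y \<Longrightarrow> x \<in> Rpow N"
  by (auto simp: dyns_def)

lemma dyn_map_dyns: "tgt \<phi> = M \<Longrightarrow> dyn_map \<phi> \<upsilon> \<in> dyns M"
  by (auto simp: dyn_map_def dyns_def)

lemma dyn_map_apply: "y \<in> Rpow (tgt \<phi>) \<Longrightarrow> dyn_map \<phi> \<upsilon> y = pushforward \<phi> ` \<upsilon> (pullback \<phi> y)"
  by (simp add: dyn_map_def)

lemma dyn_map_ident:
  assumes "\<upsilon> \<in> dyns N"
  shows "dyn_map (ident N) \<upsilon> = \<upsilon>"
proof (rule dyns_eqI[of _ N])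
  fix y assume "y \<in> Rpow N"
  then show "dyn_map (ident N) \<upsilon> y = \<upsilon> y"
    using dyns_vec[OF assms] by (force simp: dyn_map_apply pullback_ident pushforward_ident)
qed (simp_all add: assms dyn_map_dyns)

lemma dyn_map_mor_comp:
  assumes "finite (src \<phi>)" "finite (tgt \<phi>)" "is_map \<phi>" "tgt \<phi> = src \<psi>"
  shows "dyn_map (mor_comp \<psi> \<phi>) \<upsilon> = dyn_map \<psi> (dyn_map \<phi> \<upsilon>)"
  by (rule dyns_eqI[of _ "tgt \<psi>"])
    (use assms in \<open>simp_all add: dyn_map_dyns dyn_map_apply pullback_mor_comp
      pushforward_mor_comp image_image\<close>)

text \<open>The working form of the product comparison: a choice of one vector from each factor, with no sum
  left. All later proofs about \<open>dyn_sum\<close> start from here.\<close>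

lemma dyn_sum_apply:
  assumes "z \<in> Rpow (dsum N M)"
  shows "dyn_sum N M \<upsilon> \<rho> z = (\<Union>a\<in>\<upsilon> (pullback (incl_left N M) z).
    \<Union>b\<in>\<rho> (pullback (incl_right N M) z). {vjoin N M a b})"
proof -
  have "dyn_sum N M \<upsilon> \<rho> z =
    {\<lambda>i\<in>dsum N M. pushforward (incl_left N M) a i + pushforward (incl_right N M) b i | a b.
      a \<in> \<upsilon> (pullback (incl_left N M) z) \<and> b \<in> \<rho> (pullback (incl_right N M) z)}"
    using assms by (auto simp: dyn_sum_def minkowski_def dyn_map_apply)
  then show ?thesis
    unfolding vjoin_eq_sum by blast
qed

lemma dyn_sum_dyns: "dyn_sum N M \<upsilon> \<rho> \<in> dyns (dsum N M)"
proof -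
  have "dyn_sum N M \<upsilon> \<rho> z \<subseteq> Rpow (dsum N M)" if "z \<in> Rpow (dsum N M)" for z
    using that by (auto simp: dyn_sum_apply)
  then show ?thesis
    by (auto simp: dyns_def dyn_sum_def)
qed

lemma dyn_map_dyn_sum_apply:
  assumes "src \<phi> = dsum N M" "z \<in> Rpow (tgt \<phi>)"
  shows "dyn_map \<phi> (dyn_sum N M \<upsilon> \<rho>) z =
    (\<Union>a\<in>\<upsilon> (pullback (incl_left N M) (pullback \<phi> z)).
      \<Union>b\<in>\<rho> (pullback (incl_right N M) (pullback \<phi> z)). {pushforward \<phi> (vjoin N M a b)})"
  using assms by (simp add: dyn_map_apply dyn_sum_apply image_UN)

text \<open>Restriction to a summand commutes with pulling back along \<open>f + g\<close>, and pushing a join forward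
  along \<open>f + g\<close> pushes its components forward along \<open>f\<close> and \<open>g\<close>.\<close>

lemma dyn_sum_natural:
  assumes "is_map f" "is_map g"
  shows "dyn_sum (tgt f) (tgt g) (dyn_map f \<upsilon>) (dyn_map g \<rho>)
    = dyn_map (dsum_map f g) (dyn_sum (src f) (src g) \<upsilon> \<rho>)"
proof (rule dyns_eqI[of _ "dsum (tgt f) (tgt g)"])
  fix z :: "'a vec" assume z: "z \<in> Rpow (dsum (tgt f) (tgt g))"
  have "pullback (incl_left (src f) (src g)) (pullback (dsum_map f g) z)
      = pullback f (pullback (incl_left (tgt f) (tgt g)) z)"
    by (rule vec_eqI[of _ "src f"]) (simp_all add: assms is_map_apply)
  moreover have "pullback (incl_right (src f) (src g)) (pullback (dsum_map f g) z)
      = pullback g (pullback (incl_right (tgt f) (tgt g)) z)"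
    by (rule vec_eqI[of _ "src g"]) (simp_all add: assms is_map_apply)
  ultimately show "dyn_sum (tgt f) (tgt g) (dyn_map f \<upsilon>) (dyn_map g \<rho>) z
      = dyn_map (dsum_map f g) (dyn_sum (src f) (src g) \<upsilon> \<rho>) z"
    using z by (simp add: dyn_sum_apply dyn_map_dyn_sum_apply dyn_map_apply[of _ f] dyn_map_apply[of _ g]
        pushforward_dsum_map_vjoin)
qed (simp_all add: dyn_sum_dyns dyn_map_dyns)

text \<open>The two ways of restricting an argument to \<open>N\<close>, \<open>M\<close> and \<open>K\<close> agree, and both sides then collect
  the joins of the same triples of vectors, bracketed differently.\<close>

lemma dyn_sum_assoc:
  "dyn_map (dsum_assoc N M K) (dyn_sum (dsum N M) K (dyn_sum N M \<upsilon> \<rho>) \<sigma>)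
    = dyn_sum N (dsum M K) \<upsilon> (dyn_sum M K \<rho> \<sigma>)"
proof (rule dyns_eqI[of _ "dsum N (dsum M K)"])
  fix z :: "'a vec" assume z: "z \<in> Rpow (dsum N (dsum M K))"
  let ?w = "pullback (dsum_assoc N M K) z"
  have "pullback (incl_left N M) (pullback (incl_left (dsum N M) K) ?w)
      = pullback (incl_left N (dsum M K)) z"
    by (rule vec_eqI[of _ N]) simp_all
  moreover have "pullback (incl_right N M) (pullback (incl_left (dsum N M) K) ?w)
      = pullback (incl_left M K) (pullback (incl_right N (dsum M K)) z)"
    by (rule vec_eqI[of _ M]) simp_all
  moreover have "pullback (incl_right (dsum N M) K) ?w
      = pullback (incl_right M K) (pullback (incl_right N (dsum M K)) z)"
    by (rule vec_eqI[of _ K]) simp_all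
  ultimately show "dyn_map (dsum_assoc N M K) (dyn_sum (dsum N M) K (dyn_sum N M \<upsilon> \<rho>) \<sigma>) z
      = dyn_sum N (dsum M K) \<upsilon> (dyn_sum M K \<rho> \<sigma>) z"
    using z by (simp add: dyn_sum_apply dyn_map_dyn_sum_apply pushforward_assoc_vjoin)
qed (simp_all add: dyn_sum_dyns dyn_map_dyns)

lemma dyn_sum_swap:
  "dyn_map (dsum_swap N M) (dyn_sum N M \<upsilon> \<rho>) = dyn_sum M N \<rho> \<upsilon>"
proof (rule dyns_eqI[of _ "dsum M N"])
  fix z :: "'a vec" assume z: "z \<in> Rpow (dsum M N)"
  have "pullback (incl_left N M) (pullback (dsum_swap N M) z) = pullback (incl_right M N) z"
    by (rule vec_eqI[of _ N]) simp_all
  moreover have "pullback (incl_right N M) (pullback (dsum_swap N M) z) = pullback (incl_left M N) z"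
    by (rule vec_eqI[of _ M]) simp_all
  ultimately show "dyn_map (dsum_swap N M) (dyn_sum N M \<upsilon> \<rho>) z = dyn_sum M N \<rho> \<upsilon> z"
    using z by (auto simp: dyn_sum_apply dyn_map_dyn_sum_apply pushforward_swap_vjoin)
qed (simp_all add: dyn_sum_dyns dyn_map_dyns)

text \<open>The element picked by the unit comparison. Its single value is the unique vector on the empty
  set, and joining with that vector adds no coordinates.\<close>

definition zero_dyn :: "'a dyn" where
  "zero_dyn = (\<lambda>x\<in>Rpow {}. {\<lambda>i\<in>{}. 0})"

lemma zero_dyn_dyns: "zero_dyn \<in> dyns {}"
  by (auto simp: zero_dyn_def dyns_def Rpow_def)

lemma dyn_sum_lunit:
  assumes "\<upsilon> \<in> dyns N"
  shows "dyn_map (arrow (dsum {} N) N (\<lambda>z. case z of InR x \<Rightarrow> x)) (dyn_sum {} N zero_dyn \<upsilon>) = \<upsilon>"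
    (is "dyn_map ?l _ = _")
proof (rule dyns_eqI[of _ N])
  fix y assume y: "y \<in> Rpow N"
  have "pullback (incl_right {} N) (pullback ?l y) = y"
    by (rule vec_eqI[of _ N]) (simp_all add: y)
  then show "dyn_map ?l (dyn_sum {} N zero_dyn \<upsilon>) y = \<upsilon> y"
    using y dyns_vec[OF assms y]
    by (simp add: dyn_sum_apply dyn_map_dyn_sum_apply pushforward_lunit_vjoin zero_dyn_def
        SUP_empty cong: SUP_cong_simp)
qed (simp_all add: assms dyn_map_dyns)

lemma dyn_sum_runit:
  assumes "\<upsilon> \<in> dyns N"
  shows "dyn_map (arrow (dsum N {}) N (\<lambda>z. case z of InL x \<Rightarrow> x)) (dyn_sum N {} \<upsilon> zero_dyn) = \<upsilon>"
    (is "dyn_map ?r _ = _")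
proof (rule dyns_eqI[of _ N])
  fix y assume y: "y \<in> Rpow N"
  have "pullback (incl_left N {}) (pullback ?r y) = y"
    by (rule vec_eqI[of _ N]) (simp_all add: y)
  then show "dyn_map ?r (dyn_sum N {} \<upsilon> zero_dyn) y = \<upsilon> y"
    using y dyns_vec[OF assms y]
    by (simp add: dyn_sum_apply dyn_map_dyn_sum_apply pushforward_runit_vjoin zero_dyn_def
        SUP_empty cong: SUP_cong_simp)
qed (simp_all add: assms dyn_map_dyns)

section \<open>The lax symmetric monoidal functor\<close>

lemma mk_dyn_NDD [simp]: "\<upsilon> \<in> dyns N \<Longrightarrow> mk_dyn \<upsilon> \<in> NDD N"
  by (simp add: NDD_def)

lemma NDD_E:
  assumes "p \<in> NDD N"
  obtains \<upsilon> where "p = mk_dyn \<upsilon>" "\<upsilon> \<in> dyns N"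
  using assms by (auto simp: NDD_def)

text \<open>The following rules remove the tagging by \<open>mk_dyn\<close> and \<open>Pr\<close>: an equation between arrows of the
  category of sets becomes an equation between dynamics.\<close>

lemma NDD_map_simps [simp]:
  "src (NDD_map \<phi>) = NDD (src \<phi>)" "tgt (NDD_map \<phi>) = NDD (tgt \<phi>)"
  "\<upsilon> \<in> dyns (src \<phi>) \<Longrightarrow> fn (NDD_map \<phi>) (mk_dyn \<upsilon>) = mk_dyn (dyn_map \<phi> \<upsilon>)"
  "NDD (src \<phi>) = A \<Longrightarrow> fn (NDD_map \<phi>) \<in> extensional A"
  "is_map (NDD_map \<phi>)"
  by (auto simp: NDD_map_def dyn_map_dyns NDD_def) (auto simp: mk_dyn_def dyn_map_dyns)

lemma NDD_prod_simps [simp]: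
  "src (NDD_prod N M) = cprod (NDD N) (NDD M)" "tgt (NDD_prod N M) = NDD (dsum N M)"
  "\<upsilon> \<in> dyns N \<Longrightarrow> \<rho> \<in> dyns M
    \<Longrightarrow> fn (NDD_prod N M) (Pr (mk_dyn \<upsilon>) (mk_dyn \<rho>)) = mk_dyn (dyn_sum N M \<upsilon> \<rho>)"
  "cprod (NDD N) (NDD M) = A \<Longrightarrow> fn (NDD_prod N M) \<in> extensional A"
  "is_map (NDD_prod N M)"
  by (auto simp: NDD_prod_def NDD_def elim!: cprodE) (auto simp: mk_dyn_def dyn_sum_dyns)

lemma NDD_unit_simps [simp]:
  "src NDD_unit = {Star}" "tgt NDD_unit = NDD {}" "fn NDD_unit Star = mk_dyn zero_dyn"
  "fn NDD_unit \<in> extensional {Star}" "is_map NDD_unit"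
  by (simp_all add: NDD_unit_def zero_dyn_dyns flip: zero_dyn_def)

theorem lemma5p3:
  "lax_symmetric_monoidal_functor
     (FinSet_plus :: ('a elt set, 'a elt mor) moncat)
     (Set_times :: (('a dyn + 'c) tup set, ('a dyn + 'c) tup mor) moncat)
     NDD NDD_map NDD_prod NDD_unit"
proof -
  \<comment> \<open>With both base categories known, only the axioms on the functor and its comparisons remain.\<close>
  interpret C: symmetric_monoidal_category "FinSet_plus :: ('a elt set, 'a elt mor) moncat"
    by (rule symmetric_monoidal_FinSet_plus)
  interpret D: symmetric_monoidal_category
    "Set_times :: (('a dyn + 'c) tup set, ('a dyn + 'c) tup mor) moncat"
    by (rule symmetric_monoidal_Set_times)
  show ?thesis
    apply unfold_locales
    subgoal by simp
    subgoal by (auto simp: Hom_FinSet_plus Hom_Set_times)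
    subgoal by (auto simp: dyn_map_ident intro!: mor_eqI elim!: NDD_E)
    subgoal by (auto simp: Hom_FinSet_plus dyn_map_mor_comp dyn_map_dyns intro!: mor_eqI elim!: NDD_E)
    subgoal by (auto simp: Hom_Set_times)
    subgoal by (auto simp: Hom_Set_times)
    subgoal by (auto simp: Hom_FinSet_plus dyn_map_dyns dyn_sum_dyns dyn_sum_natural
          intro!: mor_eqI elim!: cprodE NDD_E)
    subgoal by (auto simp: dyn_sum_dyns dyn_sum_assoc intro!: mor_eqI elim!: cprodE NDD_E)
    subgoal by (auto simp: dyn_sum_dyns zero_dyn_dyns dyn_sum_lunit
          intro!: mor_eqI elim!: cprodE NDD_E)
    subgoal by (auto simp: dyn_sum_dyns zero_dyn_dyns dyn_sum_runit
          intro!: mor_eqI elim!: cprodE NDD_E)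
    subgoal by (auto simp: dyn_sum_dyns dyn_sum_swap intro!: mor_eqI elim!: cprodE NDD_E)
    done
qed

end
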